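(* Let $0<p<1$ and let $N\ge 1$ be an integer. Consider a deck of $N$ cards whose labels are independent, identically distributed with the geometric distribution $\mathcal{G}_p$ on $\{1,2,3,\dots\}$, and suppose that the subject and the magician each choose a secret number from $\mathcal{G}_p$, independently of each other and of the deck. Let $t$ be the coupling time of the two Kruskal counts performed on this common deck. Then $$\mathrm{Prob}[t>N]=p^N(2-p)^N .$$
   Context: The geometric distribution $\mathcal{G}_p$ on $\{1,2,3,\dots\}$ assigns probability $\pi_k=(1-p)p^{k-1}$ to $k$. Kruskal counting procedure: the cards of a deck are in positions $1,2,3,\dots$, and the card in position $m$ carries a positive integer label $v_m$. A player with secret number $s\ge 1$ has first key card at position $s$; if a key card is at position $m$, the next key card is at position $m+v_m$. The procedure stops when the deck is exhausted. Both players use the same deck (the same labels $v_m$). Coupling time: $t$ is the smallest position $M$ such that the card in position $M$ is a key card for both the magician and the subject ($t=+\infty$ if there is none). The event $[t>N]$ is the event that magician and subject have no common key card in positions $1$ through $N$. *)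

theory Defs
  imports "HOL-Probability.Probability" "HOL-Library.Extended_Nat"
begin

text \<open>The library's \<open>geometric_pmf q\<close> lives on \<open>{0, 1, 2, \<dots>}\<close> and has success probability \<open>q\<close>;
  here the support is \<open>{1, 2, 3, \<dots>}\<close> and \<open>p\<close> is the failure probability.\<close>

definition geometric1_pmf :: "real \<Rightarrow> nat pmf" where
  "geometric1_pmf p = map_pmf Suc (geometric_pmf (1 - p))"

lemma pmf_geometric1:
  assumes "0 < p" "p < 1" "k \<ge> 1"
  shows "pmf (geometric1_pmf p) k = (1 - p) * p ^ (k - 1)"
proof -
  obtain j where "k = Suc j" using assms(3) by (cases k) auto
  then show ?thesis
    using assms by (simp add: geometric1_pmf_def pmf_map_inj')
qed

text \<open>In a deck of \<open>N\<close> cards with labels \<open>v 1, \<dots>, v N\<close>, the positions of the key cards of a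
  player with secret number \<open>s\<close>. There is none if \<open>s > N\<close>.\<close>

inductive_set key_cards :: "nat \<Rightarrow> (nat \<Rightarrow> nat) \<Rightarrow> nat \<Rightarrow> nat set"
  for N :: nat and v :: "nat \<Rightarrow> nat" and s :: nat where
  first: "1 \<le> s \<Longrightarrow> s \<le> N \<Longrightarrow> s \<in> key_cards N v s"
| "next": "m \<in> key_cards N v s \<Longrightarrow> m + v m \<le> N \<Longrightarrow> m + v m \<in> key_cards N v s"

text \<open>The infimum of the empty set in \<^typ>\<open>enat\<close> is \<open>\<infinity>\<close>.\<close>

definition coupling_time :: "nat \<Rightarrow> (nat \<Rightarrow> nat) \<Rightarrow> nat \<Rightarrow> nat \<Rightarrow> enat" where
  "coupling_time N v s s' = Inf (enat ` (key_cards N v s \<inter> key_cards N v s'))"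

text \<open>Indices of the random choices: the two secret numbers and the label of the card in position \<open>m\<close>.\<close>

datatype draw = Subject | Magician | Card nat

definition draws :: "nat \<Rightarrow> draw set" where
  "draws N = {Subject, Magician} \<union> Card ` {1..N}"

end

theory Submission
  imports Defs
begin

text \<open>Remove the top card. Since the geometric distribution is memoryless, after removal the
  distances to the next key cards of the two players are again independent and geometric: a distance
  \<open>s > 1\<close> becomes \<open>s - 1\<close>, and a distance \<open>1\<close> is replaced by the label of the removed card, which
  is used for at most one player unless both meet there. The players meet at the top card with
  probability \<open>(1 - p)\<^sup>2\<close>, so each card contributes a factor \<open>1 - (1 - p)\<^sup>2 = p (2 - p)\<close>.\<close>

section \<open>Key cards and removal of the top card\<close>

lemma key_cards_subset: "key_cards N v s \<subseteq> {1..N}"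
proof
  fix m assume "m \<in> key_cards N v s"
  then show "m \<in> {1..N}" by induction auto
qed

text \<open>The rest of the deck is again a deck, with positions lowered by one; a player starting
  on the top card enters it with \<open>v 1\<close> as secret number. If \<open>v 1 = 0\<close>,
  that player stays on the top card, in accordance with secret number 0 having no key cards.\<close>

lemma key_cards_Suc_Suc:
  "key_cards (Suc N) v (Suc s) =
     (if s = 0 then insert 1 (Suc ` key_cards N (\<lambda>m. v (Suc m)) (v 1))
      else Suc ` key_cards N (\<lambda>m. v (Suc m)) s)" (is "?L = ?R")
proof
  show "?L \<subseteq> ?R"
  proof
    fix m assume "m \<in> ?L"
    then show "m \<in> ?R"
    proof induction
      case first
      then show ?case by (auto intro!: imageI key_cards.first)
    next
      case ("next" m)
      show ?case
      proof (cases "m = 1")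
        case True
        \<comment> \<open>Position 1 lies in no shifted set, so \<open>s = 0\<close>; the move
          either stays on the top card (\<open>v 1 = 0\<close>) or reaches the first key card of the
          rest.\<close>
        with "next" show ?thesis
          using key_cards_subset[of N "\<lambda>m. v (Suc m)" s]
          by (cases "v 1") (auto intro!: key_cards.first split: if_splits)
      next
        case False
        with "next"(3) obtain k where k: "m = Suc k"
          "k \<in> key_cards N (\<lambda>m. v (Suc m)) (if s = 0 then v 1 else s)"
          by (auto split: if_splits)
        then have "k + v (Suc k) \<in> key_cards N (\<lambda>m. v (Suc m)) (if s = 0 then v 1 else s)"
          using "next"(2) key_cards.next[OF k(2)] by simp
        then show ?thesis using k(1) by (auto split: if_splits)
      qed
    qed
  qed
  have tail: "Suc m \<in> ?L" if "m \<in> key_cards N (\<lambda>m. v (Suc m)) (if s = 0 then v 1 else s)" for m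
    using that
  proof induction
    case first
    have "1 + v 1 \<in> ?L" if "s = 0" 
      using first that key_cards.next[OF key_cards.first[of 1 "Suc N" v]] by simp
    with first show ?case by (auto intro: key_cards.first split: if_splits)
  next
    case ("next" m)
    then show ?case using key_cards.next[of "Suc m" "Suc N" v "Suc s"] by simp
  qed
  then show "?R \<subseteq> ?L" by (auto intro: key_cards.first split: if_splits)
qed

lemma key_cards_zero [simp]: "key_cards N v 0 = {}"
proof -
  have False if "m \<in> key_cards N v 0" for m using that by induction auto
  then show ?thesis by auto
qed

text \<open>The arguments \<open>s\<close> and \<open>s'\<close> are the distances to the next key cards of the two players,
  counted from the card before the remaining deck; \<open>0\<close> means that there is no further key card,
  which happens after a label \<open>0\<close>, where the player is stuck.\<close>

fun no_meet :: "nat list \<Rightarrow> nat \<Rightarrow> nat \<Rightarrow> bool" where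
  "no_meet [] s s' \<longleftrightarrow> True"
| "no_meet (x # xs) s s' \<longleftrightarrow> \<not> (s = 1 \<and> s' = 1) \<and>
     no_meet xs (if s = 1 then x else s - 1) (if s' = 1 then x else s' - 1)"

text \<open>Both counts lose the top card together, and \<open>no_meet\<close> passes on exactly the
  resulting distances. Labels shift and distances change, so the induction generalises over all
  three.\<close>

lemma key_cards_disjoint_iff_no_meet:
  "key_cards N v s \<inter> key_cards N v s' = {} \<longleftrightarrow> no_meet (map v [1..<Suc N]) s s'"
proof (induction N arbitrary: v s s')
  case 0
  then show ?case using key_cards_subset[of 0 v s] by auto
next
  case (Suc N)
  let ?w = "\<lambda>m. v (Suc m)"
  have "[1..<Suc (Suc N)] = 1 # map Suc [1..<Suc N]"
    by (simp only: map_Suc_upt) (simp add: upt_conv_Cons)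
  then have map: "map v [1..<Suc (Suc N)] = v 1 # map ?w [1..<Suc N]"
    by (simp del: upt_Suc)
  have zero: "0 \<notin> key_cards N ?w r" for r using key_cards_subset[of N ?w r] by auto
  have inj: "Suc ` A \<inter> Suc ` B = {} \<longleftrightarrow> A \<inter> B = {}" for A B by auto
  have one: "1 \<notin> Suc ` key_cards N ?w r" for r using zero by auto
  \<comment> \<open>For \<open>r = 0\<close> both sides are empty, as truncated subtraction keeps
    0.\<close>
  have step: "key_cards (Suc N) v r = (if r = 1 then {1} else {}) \<union>
      Suc ` key_cards N ?w (if r = 1 then v 1 else r - 1)" for r
    by (cases r) (auto simp: key_cards_Suc_Suc)
  \<comment> \<open>Since 1 is in no shifted set, the mixed intersections vanish.\<close>
  have "key_cards (Suc N) v s \<inter> key_cards (Suc N) v s' = {} \<longleftrightarrow> \<not> (s = 1 \<and> s' = 1) \<and>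
      Suc ` key_cards N ?w (if s = 1 then v 1 else s - 1) \<inter>
      Suc ` key_cards N ?w (if s' = 1 then v 1 else s' - 1) = {}"
    unfolding step using one by (auto simp del: One_nat_def)
  then show ?case
    unfolding map no_meet.simps Suc.IH[symmetric] inj .
qed

text \<open>All key cards lie in \<open>{1..N}\<close>, so the infimum is either at most
  \<open>N\<close> or, over the empty set, infinite.\<close>

lemma coupling_time_gt_iff_no_meet:
  "coupling_time N v s s' > enat N \<longleftrightarrow> no_meet (map v [1..<Suc N]) s s'"
proof -
  let ?K = "key_cards N v s \<inter> key_cards N v s'"
  have "coupling_time N v s s' \<le> enat N" if "m \<in> ?K" for m
  proof -
    have "coupling_time N v s s' \<le> enat m"
      unfolding coupling_time_def using that by (intro Inf_lower) auto
    also have "\<dots> \<le> enat N" using that key_cards_subset[of N v s] by auto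
    finally show ?thesis .
  qed
  moreover have "coupling_time N v s s' = \<infinity>" if "?K = {}"
    unfolding coupling_time_def that by (simp add: top_enat_def)
  ultimately have "coupling_time N v s s' > enat N \<longleftrightarrow> ?K = {}"
    by (cases "?K = {}") (auto simp: not_le[symmetric])
  then show ?thesis by (simp only: key_cards_disjoint_iff_no_meet)
qed

section \<open>Memorylessness and the recursion in the number of cards\<close>

lemma no_meet_sym: "no_meet xs s s' \<longleftrightarrow> no_meet xs s' s"
  by (induction xs arbitrary: s s') auto

text \<open>Condition on the first trial: after a failure the same wait starts afresh, one step
  later.\<close>

lemma geometric1_pmf_unfold:
  assumes "0 < p" "p < 1"
  shows "geometric1_pmf p = bernoulli_pmf (1 - p) \<bind>
    (\<lambda>b. if b then return_pmf 1 else map_pmf Suc (geometric1_pmf p))"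
proof -
  have "geometric_pmf (1 - p) = bernoulli_pmf (1 - p) \<bind>
      (\<lambda>b. if b then return_pmf 0 else map_pmf Suc (geometric_pmf (1 - p)))"
    using assms by (intro geometric_bind_pmf_unfold) auto
  then have "geometric1_pmf p = map_pmf Suc (bernoulli_pmf (1 - p) \<bind>
      (\<lambda>b. if b then return_pmf 0 else map_pmf Suc (geometric_pmf (1 - p))))"
    by (simp add: geometric1_pmf_def)
  also have "\<dots> = bernoulli_pmf (1 - p) \<bind>
      (\<lambda>b. if b then return_pmf 1 else map_pmf Suc (geometric1_pmf p))"
    by (auto simp: map_bind_pmf geometric1_pmf_def intro!: bind_pmf_cong)
  finally show ?thesis .
qed

lemma nn_integral_geometric1_pmf:
  assumes "0 < p" "p < 1"
  shows "(\<integral>\<^sup>+k. f k \<partial>geometric1_pmf p) =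
    ennreal (1 - p) * f 1 + ennreal p * (\<integral>\<^sup>+k. f (Suc k) \<partial>geometric1_pmf p)"
proof -
  have "(\<integral>\<^sup>+k. f k \<partial>geometric1_pmf p) = (\<integral>\<^sup>+k. f k \<partial>measure_pmf (bernoulli_pmf (1 - p) \<bind>
      (\<lambda>b. if b then return_pmf 1 else map_pmf Suc (geometric1_pmf p))))"
    using geometric1_pmf_unfold[OF assms] by simp
  also have "\<dots> = ennreal (1 - p) * f 1 + ennreal p * (\<integral>\<^sup>+k. f (Suc k) \<partial>geometric1_pmf p)"
    using assms by (simp add: mult.commute)
  finally show ?thesis .
qed

text \<open>Condition on the subject's distance. If it is 1 (probability \<open>1 - p\<close>), the
  magician's must exceed 1 (probability \<open>p\<close>); if it is larger, the top card is
  harmless. In both cases two independent geometric distances remain, giving the factor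
  \<open>(1 - p) * p + p\<close>.\<close>

lemma nn_integral_no_meet_geometric1:
  assumes "0 < p" "p < 1"
  shows "(\<integral>\<^sup>+s. \<integral>\<^sup>+s'. \<integral>\<^sup>+xs. of_bool (no_meet xs s s')
      \<partial>replicate_pmf n (geometric1_pmf p) \<partial>geometric1_pmf p \<partial>geometric1_pmf p)
    = ennreal (p * (2 - p)) ^ n"
proof (induction n)
  case 0
  then show ?case by simp
next
  case (Suc n)
  let ?G = "geometric1_pmf p"
  define h where "h n s s' = (\<integral>\<^sup>+xs. of_bool (no_meet xs s s') \<partial>replicate_pmf n ?G)" for n s s'
  define F where "F = (\<integral>\<^sup>+s. \<integral>\<^sup>+s'. h n s s' \<partial>?G \<partial>?G)"
  \<comment> \<open>A congruence rule: \<open>?G\<close> charges only positive numbers, so a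
    distance \<open>Suc s\<close> under the integral may be taken to exceed 1.\<close>
  have pos: "(\<integral>\<^sup>+s. f s \<partial>?G) = (\<integral>\<^sup>+s. g s \<partial>?G)"
    if "\<And>s. s > 0 \<Longrightarrow> f s = g s" for f g :: "nat \<Rightarrow> ennreal"
    by (intro nn_integral_cong_AE) (auto simp: AE_measure_pmf_iff geometric1_pmf_def that)
  have sym: "h n s s' = h n s' s" for s s'
    unfolding h_def by (subst no_meet_sym) simp
  have h11: "h (Suc n) 1 1 = 0" by (simp add: h_def)
  \<comment> \<open>The removed label \<open>x\<close> is the subject's fresh distance; symmetry
    makes it the inner variable, as in \<open>F\<close>, without exchanging integrals.\<close>
  have h1: "h (Suc n) 1 (Suc s') = (\<integral>\<^sup>+x. h n s' x \<partial>?G)" if "s' > 0" for s'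
    unfolding sym[of s'] using that by (simp add: h_def)
  have h2: "h (Suc n) (Suc s) 1 = (\<integral>\<^sup>+x. h n s x \<partial>?G)" if "s > 0" for s
    using that by (simp add: h_def)
  have h3: "h (Suc n) (Suc s) (Suc s') = h n s s'" if "s > 0" "s' > 0" for s s'
    using that by (simp add: h_def)
  have one: "(\<integral>\<^sup>+s'. h (Suc n) 1 s' \<partial>?G) = ennreal p * F"
    unfolding nn_integral_geometric1_pmf[OF assms, of "h (Suc n) 1"] F_def h11
    by (simp only: h1 cong: pos) simp
  \<comment> \<open>The magician's next distance has law \<open>?G\<close> whether it is the removed
    label or the old distance, given to exceed 1, reduced by one.\<close>
  have later: "(\<integral>\<^sup>+s'. h (Suc n) (Suc s) s' \<partial>?G) = (\<integral>\<^sup>+s'. h n s s' \<partial>?G)" (is "_ = ?g")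
    if "s > 0" for s
  proof -
    have "(\<integral>\<^sup>+s'. h (Suc n) (Suc s) s' \<partial>?G) = ennreal (1 - p) * ?g + ennreal p * ?g"
      unfolding nn_integral_geometric1_pmf[OF assms, of "h (Suc n) (Suc s)"] h2[OF that]
      by (simp only: h3[OF that] cong: pos)
    also have "\<dots> = ennreal (1 - p + p) * ?g"
      using assms by (subst ennreal_plus) (simp_all add: distrib_right)
    finally show ?thesis by simp
  qed
  have "(\<integral>\<^sup>+s. \<integral>\<^sup>+s'. h (Suc n) s s' \<partial>?G \<partial>?G) = ennreal (1 - p) * (ennreal p * F) + ennreal p * F"
    unfolding nn_integral_geometric1_pmf[OF assms, of "\<lambda>s. \<integral>\<^sup>+s'. h (Suc n) s s' \<partial>?G"] one
    by (simp only: later F_def cong: pos)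
  also have "\<dots> = ennreal ((1 - p) * p + p) * F"
    using assms by (simp add: ennreal_plus ennreal_mult distrib_right mult.assoc)
  also have "(1 - p) * p + p = p * (2 - p)" by (simp add: algebra_simps)
  also have "F = ennreal (p * (2 - p)) ^ n"
    using Suc.IH by (simp add: F_def h_def)
  finally show ?case by (simp add: h_def)
qed

section \<open>The joint law of the draws\<close>

lemma pmf_replicate_pmf:
  "pmf (replicate_pmf n p) xs = (if length xs = n then \<Prod>i<n. pmf p (xs ! i) else 0)"
proof (induction n arbitrary: xs)
  case 0
  then show ?case by (auto simp: pmf_return indicator_def)
next
  case (Suc n)
  have eq: "replicate_pmf (Suc n) p = map_pmf (\<lambda>(x, xs). x # xs) (pair_pmf p (replicate_pmf n p))"
    by (simp add: pair_pmf_def map_bind_pmf)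
  show ?case
  proof (cases xs)
    case Nil
    then show ?thesis unfolding eq by (auto simp: pmf_eq_0_set_pmf)
  next
    case (Cons y ys)
    have "inj (\<lambda>(x :: 'a, xs). x # xs)" by (auto simp: inj_def)
    from pmf_map_inj'[OF this, of "pair_pmf p (replicate_pmf n p)" "(y, ys)"] 
    show ?thesis unfolding eq Cons
      by (simp add: pmf_pair Suc.IH prod.lessThan_Suc_shift del: prod.lessThan_Suc)
  qed
qed

text \<open>Transfers the problem from an arbitrary probability space to lists. These form a
  countable type, so comparing point masses suffices, and independence turns those into
  products.\<close>

lemma (in prob_space) distr_map_indep_vars:
  fixes X :: "'i \<Rightarrow> 'a \<Rightarrow> 'c :: countable"
  assumes indep: "indep_vars (\<lambda>_. count_space UNIV) X (set ds)" and "distinct ds"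
    and distr: "\<And>i. i \<in> set ds \<Longrightarrow> distr M (count_space UNIV) (X i) = measure_pmf G"
  shows "distr M (count_space UNIV) (\<lambda>\<omega>. map (\<lambda>i. X i \<omega>) ds) = replicate_pmf (length ds) G"
    and "(\<lambda>\<omega>. map (\<lambda>i. X i \<omega>) ds) \<in> M \<rightarrow>\<^sub>M count_space UNIV"
proof -
  let ?Y = "\<lambda>\<omega>. map (\<lambda>i. X i \<omega>) ds"
  have rv: "X i \<in> M \<rightarrow>\<^sub>M count_space UNIV" if "i \<in> set ds" for i
    using indep that by (auto simp: indep_vars_def)
  \<comment> \<open>\<open>map_of (zip ds xs)\<close> reads \<open>xs\<close> as an assignment to
    the distinct indices, so the event becomes an intersection over \<open>set ds\<close>.\<close>
  have vimage: "?Y -` {xs} \<inter> space M = (if length xs = length ds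
      then {\<omega> \<in> space M. \<forall>i\<in>set ds. X i \<omega> = the (map_of (zip ds xs) i)} else {})" for xs
    using \<open>distinct ds\<close>
    by (auto simp: list_eq_iff_nth_eq all_set_conv_all_nth map_of_zip_nth)
  show meas: "?Y \<in> M \<rightarrow>\<^sub>M count_space UNIV"
  proof (subst measurable_count_space_eq_countable)
    show "countable (UNIV :: 'c list set)" by simp
    show "?Y \<in> space M \<rightarrow> UNIV \<and> (\<forall>xs\<in>UNIV. ?Y -` {xs} \<inter> space M \<in> sets M)"
      unfolding vimage using rv by auto
  qed
  show "distr M (count_space UNIV) ?Y = replicate_pmf (length ds) G"
  proof (rule measure_eqI_countable[where A = UNIV])
    fix xs :: "'c list"
    show "emeasure (distr M (count_space UNIV) ?Y) {xs} = emeasure (replicate_pmf (length ds) G) {xs}"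
    proof (cases "length xs = length ds")
      case True
      let ?f = "\<lambda>i. the (map_of (zip ds xs) i)"
      have "prob {\<omega> \<in> space M. \<forall>i\<in>set ds. X i \<omega> = ?f i} = (\<Prod>i\<in>set ds. pmf G (?f i))"
      \<comment> \<open>The empty list is split off: an intersection over no indices would be
        \<open>UNIV\<close> instead of \<open>space M\<close>.\<close>
      proof (cases "ds = []")
        case False
        have "{\<omega> \<in> space M. \<forall>i\<in>set ds. X i \<omega> = ?f i} = (\<Inter>i\<in>set ds. X i -` {?f i} \<inter> space M)"
          using False by (auto simp: neq_Nil_conv)
        also have "prob \<dots> = (\<Prod>i\<in>set ds. prob (X i -` {?f i} \<inter> space M))"
          using False by (intro indep_varsD[OF indep]) auto
        also have "\<dots> = (\<Prod>i\<in>set ds. pmf G (?f i))"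
        proof (intro prod.cong refl)
          fix i assume i: "i \<in> set ds"
          show "prob (X i -` {?f i} \<inter> space M) = pmf G (?f i)"
            unfolding measure_pmf_single[symmetric] distr[OF i, symmetric]
            by (subst measure_distr[OF rv[OF i]]) auto
        qed
        finally show ?thesis .
      qed (simp add: prob_space)
      also have "\<dots> = (\<Prod>j<length ds. pmf G (?f (ds ! j)))"
        using prod.reindex_bij_betw[OF bij_betw_nth[OF \<open>distinct ds\<close> refl refl], of "\<lambda>i. pmf G (?f i)"]
        by simp
      also have "\<dots> = pmf (replicate_pmf (length ds) G) xs"
        using True \<open>distinct ds\<close> by (simp add: pmf_replicate_pmf map_of_zip_nth)
      finally show ?thesis
        using True by (simp add: emeasure_distr[OF meas] vimage emeasure_eq_measure emeasure_pmf_single)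
    next
      case False
      then show ?thesis
        by (simp add: emeasure_distr[OF meas] vimage emeasure_pmf_single pmf_replicate_pmf)
    qed
  qed auto
qed

section \<open>The probability that the two counts never meet\<close>

theorem theorem3p1:
  fixes M :: "'a measure" and X :: "draw \<Rightarrow> 'a \<Rightarrow> nat" and p :: real and N :: nat
  assumes "prob_space M"
    and "0 < p" and "p < 1" and "N \<ge> 1"
    and "prob_space.indep_vars M (\<lambda>_. count_space UNIV) X (draws N)"
    and "\<And>i. i \<in> draws N \<Longrightarrow> distr M (count_space UNIV) (X i) = measure_pmf (geometric1_pmf p)"
  shows "measure M {\<omega> \<in> space M.
           coupling_time N (\<lambda>m. X (Card m) \<omega>) (X Subject \<omega>) (X Magician \<omega>) > enat N}
         = p ^ N * (2 - p) ^ N"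
proof -
  interpret prob_space M by fact
  let ?G = "geometric1_pmf p"
  \<comment> \<open>With the secret numbers in front, splitting off two entries of
    \<open>replicate_pmf\<close> yields the triple integral of the recursion.\<close>
  define ds where "ds = Subject # Magician # map Card [1..<Suc N]"
  define Y where "Y \<omega> = map (\<lambda>i. X i \<omega>) ds" for \<omega>
  \<comment> \<open>The default \<open>False\<close> concerns lists of length below 2, which have no
    mass.\<close>
  define A where "A = {xs. case xs of s # s' # v \<Rightarrow> no_meet v s s' | _ \<Rightarrow> False}"
  have set_ds: "set ds = draws N"
    by (auto simp: ds_def draws_def simp del: upt_Suc)
  have "distinct ds"
    by (auto simp: ds_def distinct_map inj_on_def simp del: upt_Suc)
  have length: "length ds = Suc (Suc N)" by (simp add: ds_def del: upt_Suc)
  note joint = distr_map_indep_vars[of X ds ?G, unfolded set_ds, OF assms(5) \<open>distinct ds\<close> assms(6),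
      folded Y_def, unfolded length]
  have "{\<omega> \<in> space M.
      coupling_time N (\<lambda>m. X (Card m) \<omega>) (X Subject \<omega>) (X Magician \<omega>) > enat N} = Y -` A \<inter> space M"
    by (auto simp: coupling_time_gt_iff_no_meet Y_def A_def ds_def comp_def simp del: upt_Suc)
  then have "emeasure M {\<omega> \<in> space M.
      coupling_time N (\<lambda>m. X (Card m) \<omega>) (X Subject \<omega>) (X Magician \<omega>) > enat N}
    = emeasure (replicate_pmf (Suc (Suc N)) ?G) A"
    by (simp only: joint(1)[symmetric] emeasure_distr[OF joint(2)] sets_count_space Pow_UNIV UNIV_I)
  also have "\<dots> = (\<integral>\<^sup>+xs. of_bool (xs \<in> A) \<partial>replicate_pmf (Suc (Suc N)) ?G)"
    by (subst nn_integral_indicator[symmetric]) (auto intro!: nn_integral_cong simp: indicator_def)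
  also have "\<dots> = (\<integral>\<^sup>+s. \<integral>\<^sup>+s'. \<integral>\<^sup>+xs. of_bool (no_meet xs s s')
      \<partial>replicate_pmf N ?G \<partial>?G \<partial>?G)"
    by (simp add: A_def)
  also have "\<dots> = ennreal (p * (2 - p)) ^ N"
    using assms by (intro nn_integral_no_meet_geometric1)
  also have "\<dots> = ennreal (p ^ N * (2 - p) ^ N)"
    using assms by (simp add: ennreal_power power_mult_distrib)
  finally show ?thesis
    using assms by (simp add: measure_def)
qed
end
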